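(* There is a finite automaton with $52$ states that takes as input triples $(x,y,z)$ of non-negative integers, expressed in Zeckendorf representation and read in parallel, and accepts $(x,y,z)$ if and only if $A[x,y]=z$, where $A$ is the Hurt-Sada array.
   Context: Let $\mathbb{N}=\{0,1,2,\ldots\}$. The Hurt-Sada array $A=(A[n,k])_{n,k\ge 0}$ is defined as follows. Row $0$ is $A[0,k]=k$ for all $k\ge 0$. For $n\ge 1$, row $n$ is obtained from row $n-1$ by finding the unique occurrence of $n$ in row $n-1$, say $A[n-1,i]=n$, and shifting this entry $n$ positions to the right (it jumps over the next $n$ entries): $A[n,j]=A[n-1,j]$ for $0\le j<i$; $A[n,j]=A[n-1,j+1]$ for $i\le j<i+n$; $A[n,i+n]=n$; and $A[n,j]=A[n-1,j]$ for $j>i+n$. Each row is a permutation of $\mathbb{N}$. Zeckendorf representation: with $F_0=0$, $F_1=1$, $F_i=F_{i-1}+F_{i-2}$ for $i\geq 2$, every non-negative integer is uniquely a sum of distinct, pairwise non-adjacent Fibonacci numbers $F_i$, $i\ge 2$. The binary string $a_1a_2\cdots a_t$ (most significant digit first, no two consecutive $1$s, and no leading zeros unless padded) represents $\sum_{1\le i\le t}a_iF_{t+2-i}$; the integer $0$ is represented by the empty string. A finite automaton has a finite set of states, labeled (deterministic) transitions between states, an initial state and a set of accepting states; it reads a finite input word starting in the initial state and accepts if and only if it is in an accepting state after reading the whole word (if a needed transition is absent, the input is rejected). A tuple of integers is given as input by reading their Zeckendorf representations in parallel (one symbol of $\{0,1\}^3$ at a time for a triple), the shorter representations being padded with zeros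 at the front so that all have the same length. *)

theory Defs
  imports Complex_Main "HOL-Number_Theory.Fib"
begin

definition shift_entry :: "nat \<Rightarrow> (nat \<Rightarrow> nat) \<Rightarrow> nat \<Rightarrow> nat" where
  "shift_entry n r =
    (let i = (THE i. r i = n)
     in (\<lambda>j. if j < i then r j
             else if j < i + n then r (j + 1)
             else if j = i + n then n
             else r j))"

primrec hurt_sada :: "nat \<Rightarrow> nat \<Rightarrow> nat" where
  "hurt_sada 0 = (\<lambda>k. k)"
| "hurt_sada (Suc m) = shift_entry (Suc m) (hurt_sada m)"

lemma bij_shift_entry:
  assumes "bij r"
  shows "bij (shift_entry n r)"
proof -
  define i where "i = (THE i. r i = n)"
  have "\<exists>!i. r i = n"
    using assms by (metis bij_pointE)
  then have ri: "r i = n"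
    unfolding i_def by (rule theI')
  define p where "p = (\<lambda>j. if j < i then j else if j < i + n then j + 1
                          else if j = i + n then i else j)"
  define q where "q = (\<lambda>j. if j < i then j else if j = i then i + n
                          else if j \<le> i + n then j - 1 else j)"
  have "q \<circ> p = id" "p \<circ> q = id"
    by (auto simp: p_def q_def fun_eq_iff)
  then have "bij p" by (rule o_bij)
  moreover have "shift_entry n r = r \<circ> p"
    by (auto simp: shift_entry_def Let_def p_def ri fun_eq_iff simp flip: i_def)
  ultimately show ?thesis
    using assms by (simp add: bij_comp)
qed

text \<open>Every row is a permutation, so the description in \<^const>\<open>shift_entry\<close> is well defined.\<close>

lemma bij_hurt_sada: "bij (hurt_sada n)"
  by (induction n) (simp_all add: bij_shift_entry bij_id[unfolded id_def])

lemma hurt_sada_ex1: "\<exists>!k. hurt_sada n k = v"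
  using bij_hurt_sada[of n] by (metis bij_pointE)


text \<open>Words list the most significant digit first; \<^const>\<open>True\<close> is the digit 1.
  With 0-based positions, position \<open>i\<close> of a word of length \<open>t\<close> has weight \<open>fib (t + 1 - i)\<close>.\<close>

definition zeck_val :: "bool list \<Rightarrow> nat" where
  "zeck_val w = (\<Sum>i<length w. if w ! i then fib (length w + 1 - i) else 0)"

definition no_adjacent_ones :: "bool list \<Rightarrow> bool" where
  "no_adjacent_ones w \<longleftrightarrow> (\<forall>i. Suc i < length w \<longrightarrow> \<not> (w ! i \<and> w ! Suc i))"

definition is_zeck :: "nat \<Rightarrow> bool list \<Rightarrow> bool" where
  "is_zeck n w \<longleftrightarrow> zeck_val w = n \<and> no_adjacent_ones w \<and> (w \<noteq> [] \<longrightarrow> hd w)"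

definition zeck :: "nat \<Rightarrow> bool list" where
  "zeck n = (THE w. is_zeck n w)"

lemma zeck_val_Nil [simp]: "zeck_val [] = 0"
  by (simp add: zeck_val_def)

lemma zeck_val_Cons [simp]:
  "zeck_val (a # w) = (if a then fib (length w + 2) else 0) + zeck_val w"
proof -
  have "(\<Sum>i<length w. if w ! i then fib (length (a # w) + 1 - Suc i) else 0) = zeck_val w"
    unfolding zeck_val_def by (intro sum.cong) auto
  then show ?thesis
    unfolding zeck_val_def[of "a # w"]
    by (simp add: sum.lessThan_Suc_shift del: sum.lessThan_Suc fib.simps)
qed

lemma no_adjacent_ones_Nil [simp]: "no_adjacent_ones []"
  by (simp add: no_adjacent_ones_def)

lemma no_adjacent_ones_Cons:
  "no_adjacent_ones (a # w) \<longleftrightarrow> no_adjacent_ones w \<and> \<not> (a \<and> w \<noteq> [] \<and> hd w)"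
proof
  assume *: "no_adjacent_ones (a # w)"
  have "no_adjacent_ones w"
    unfolding no_adjacent_ones_def
  proof (intro allI impI)
    fix i assume "Suc i < length w"
    then show "\<not> (w ! i \<and> w ! Suc i)"
      using *[unfolded no_adjacent_ones_def, rule_format, of "Suc i"] by simp
  qed
  moreover have "\<not> (a \<and> w \<noteq> [] \<and> hd w)"
    using *[unfolded no_adjacent_ones_def, rule_format, of 0] by (auto simp: hd_conv_nth)
  ultimately show "no_adjacent_ones w \<and> \<not> (a \<and> w \<noteq> [] \<and> hd w)" ..
next
  assume *: "no_adjacent_ones w \<and> \<not> (a \<and> w \<noteq> [] \<and> hd w)"
  show "no_adjacent_ones (a # w)"
    unfolding no_adjacent_ones_def
  proof (intro allI impI)
    fix i assume "Suc i < length (a # w)"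
    then show "\<not> ((a # w) ! i \<and> (a # w) ! Suc i)"
      using * by (cases i) (auto simp: no_adjacent_ones_def hd_conv_nth)
  qed
qed

lemma zeck_val_less: "no_adjacent_ones w \<Longrightarrow> zeck_val w < fib (length w + 2)"
proof (induction w rule: length_induct)
  case (1 w)
  show ?case
  proof (cases w)
    case Nil
    then show ?thesis by simp
  next
    case (Cons a v)
    have v: "no_adjacent_ones v" "zeck_val v < fib (length v + 2)"
      using 1 Cons by (auto simp: no_adjacent_ones_Cons)
    show ?thesis
    proof (cases a)
      case False
      then show ?thesis using v Cons by simp
    next
      case True
      show ?thesis
      proof (cases v)
        case Nil
        then show ?thesis using Cons True by simp
      next
        case (Cons b u)
        with \<open>w = a # v\<close> True 1(2) have "\<not> b" "no_adjacent_ones u"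
          by (auto simp: no_adjacent_ones_Cons)
        moreover have "zeck_val u < fib (length u + 2)"
          using 1 \<open>w = a # v\<close> Cons \<open>no_adjacent_ones u\<close> by auto
        ultimately show ?thesis using \<open>w = a # v\<close> Cons True by simp
      qed
    qed
  qed
qed

lemma zeck_val_inj:
  "\<lbrakk>length u = length w; no_adjacent_ones u; no_adjacent_ones w; zeck_val u = zeck_val w\<rbrakk>
    \<Longrightarrow> u = w"
proof (induction u w rule: list_induct2)
  case Nil
  then show ?case by simp
next
  case (Cons a u b w)
  have "no_adjacent_ones u" "no_adjacent_ones w"
    using Cons.prems by (simp_all add: no_adjacent_ones_Cons)
  then have "zeck_val u < fib (length u + 2)" "zeck_val w < fib (length w + 2)"
    by (simp_all only: zeck_val_less)
  then have "a = b"
    using Cons.prems(3) Cons.hyps by (cases a; cases b) auto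
  then show ?case
    using Cons by (auto simp: no_adjacent_ones_Cons split: if_splits)
qed

lemma ex_zeck_val: "n < fib (l + 2) \<Longrightarrow> \<exists>w. length w = l \<and> no_adjacent_ones w \<and> zeck_val w = n"
proof (induction l arbitrary: n rule: less_induct)
  case (less l)
  show ?case
  proof (cases l)
    case 0
    then show ?thesis using less.prems by (intro exI[of _ "[]"]) simp
  next
    case (Suc m)
    show ?thesis
    proof (cases "n < fib (m + 2)")
      case True
      then obtain w where "length w = m" "no_adjacent_ones w" "zeck_val w = n"
        using less.IH[of m n] Suc by auto
      then show ?thesis
        using Suc by (intro exI[of _ "False # w"]) (simp add: no_adjacent_ones_Cons)
    next
      case big: False
      show ?thesis
      proof (cases m)
        case 0
        then show ?thesis
          using big less.prems Suc
          by (intro exI[of _ "[True]"]) (simp add: no_adjacent_ones_Cons numeral_eq_Suc)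
      next
        case m: (Suc k)
        have "n - fib (m + 2) < fib (k + 2)"
          using big less.prems Suc m by (simp add: numeral_eq_Suc)
        then obtain w where "length w = k" "no_adjacent_ones w" "zeck_val w = n - fib (m + 2)"
          using less.IH[of k] Suc m by auto
        then show ?thesis
          using big Suc m
          by (intro exI[of _ "True # False # w"]) (simp add: no_adjacent_ones_Cons)
      qed
    qed
  qed
qed

lemma no_adjacent_ones_dropWhile:
  "no_adjacent_ones w \<Longrightarrow> no_adjacent_ones (dropWhile Not w)"
  by (induction w) (auto simp: no_adjacent_ones_Cons)

lemma zeck_val_dropWhile: "zeck_val (dropWhile Not w) = zeck_val w"
  by (induction w) auto

lemma less_fib: "n < fib (n + 2)"
proof (induction n)
  case (Suc n)
  have "fib (Suc n) > 0" by (simp add: fib_neq_0_nat)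
  then show ?case using Suc by simp
qed simp

lemma is_zeck_length_le:
  assumes "is_zeck n u" "is_zeck n w"
  shows "length u \<le> length w"
proof (cases u)
  case (Cons a v)
  with assms have "fib (length u + 1) \<le> n"
    by (auto simp: is_zeck_def)
  also have "n < fib (length w + 2)"
    using assms(2) zeck_val_less[of w] unfolding is_zeck_def by (metis (no_types))
  finally have "\<not> length w + 2 \<le> length u + 1"
    using fib_mono[of "length w + 2" "length u + 1"] by linarith
  then show ?thesis by simp
qed simp

text \<open>Zeckendorf's theorem, so the description in \<^const>\<open>zeck\<close> is well defined.\<close>

lemma is_zeck_ex1: "\<exists>!w. is_zeck n w"
proof (rule ex_ex1I)
  obtain w where "no_adjacent_ones w" "zeck_val w = n"
    using ex_zeck_val[OF less_fib] by blast
  then have "is_zeck n (dropWhile Not w)"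
    using hd_dropWhile[of Not w]
    by (auto simp: is_zeck_def no_adjacent_ones_dropWhile zeck_val_dropWhile)
  then show "\<exists>w. is_zeck n w" ..
next
  fix u w assume "is_zeck n u" "is_zeck n w"
  moreover from this have "length u = length w"
    by (intro antisym is_zeck_length_le)
  ultimately show "u = w"
    by (auto simp: is_zeck_def intro: zeck_val_inj)
qed

lemma is_zeck_zeck: "is_zeck n (zeck n)"
  unfolding zeck_def by (rule theI') (rule is_zeck_ex1)

definition pad_front :: "nat \<Rightarrow> bool list \<Rightarrow> bool list" where
  "pad_front l w = replicate (l - length w) False @ w"

definition zeck_triple :: "nat \<Rightarrow> nat \<Rightarrow> nat \<Rightarrow> (bool \<times> bool \<times> bool) list" where
  "zeck_triple x y z =
    (let l = max (length (zeck x)) (max (length (zeck y)) (length (zeck z)))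
     in zip (pad_front l (zeck x)) (zip (pad_front l (zeck y)) (pad_front l (zeck z))))"


text \<open>Deterministic automata with a partial transition function: \<open>delta M q a = None\<close> means that
  state \<open>q\<close> has no transition labeled \<open>a\<close>.\<close>

record ('q, 'a) automaton =
  states :: "'q set"
  init :: 'q
  delta :: "'q \<Rightarrow> 'a \<Rightarrow> 'q option"
  accepting :: "'q set"

definition finite_automaton :: "('q, 'a) automaton \<Rightarrow> bool" where
  "finite_automaton M \<longleftrightarrow>
    finite (states M) \<and> init M \<in> states M \<and> accepting M \<subseteq> states M \<and>
    (\<forall>q \<in> states M. \<forall>a q'. delta M q a = Some q' \<longrightarrow> q' \<in> states M)"

primrec run_from :: "('q, 'a) automaton \<Rightarrow> 'q \<Rightarrow> 'a list \<Rightarrow> 'q option" where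
  "run_from M q [] = Some q"
| "run_from M q (a # w) =
    (case delta M q a of None \<Rightarrow> None | Some q' \<Rightarrow> run_from M q' w)"

definition accepts :: "('q, 'a) automaton \<Rightarrow> 'a list \<Rightarrow> bool" where
  "accepts M w \<longleftrightarrow> (\<exists>q \<in> accepting M. run_from M (init M) w = Some q)"

end

theory Submission
  imports Defs "HOL-Library.Code_Binary_Nat"
begin

text \<open>
  Let \<open>S\<close> append a 0 to a Zeckendorf representation. In row \<open>n\<close> the entries \<open>0, \<dots>, n\<close> (already
  moved) and \<open>n + 1, n + 2, \<dots>\<close> (not yet moved) each appear in increasing order. Counting positions
  together with the deletions that happened to the left, \<open>m\<close> leaves the slot \<open>S m - 1\<close> and is
  reinserted for good in the slot \<open>S (S m)\<close>; these are complementary Beatty-type sequences.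
  Hence \<open>A[n, k] = k\<close> if \<open>S k \<le> n\<close> or \<open>k > S n\<close>, and otherwise \<open>A[n, k]\<close> is the unique \<open>z\<close> with
  \<open>k + n + 1 = S z\<close> or \<open>k + n = S (S z)\<close>, which follows by induction on \<open>n\<close> from
  \<open>S (S n) = S n + n\<close>, \<open>S (S n + 1) = S (S n) + 2\<close> and \<open>S (n + 1) = S n + 1\<close> for \<open>n\<close> outside the
  range of \<open>S\<close>.

  Reading digits from the left, the two inequalities are lexicographic comparisons, and each of
  the two linear equations needs only a bounded pair of integers. The product of these trackers
  is correct by construction, and exploring its finitely many reachable states shows that it
  accepts the same valid words as an explicit table with 52 states.
\<close>

subsection \<open>Shifting Zeckendorf representations\<close>

definition zshift :: "nat \<Rightarrow> nat" where
  "zshift n = zeck_val (zeck n @ [False])"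

lemma zeck_val_zeck [simp]: "zeck_val (zeck n) = n"
  and no_adjacent_ones_zeck [simp]: "no_adjacent_ones (zeck n)"
  using is_zeck_zeck[of n] by (simp_all add: is_zeck_def)

lemma no_adjacent_ones_pad [simp]:
  "no_adjacent_ones (replicate k False @ w) \<longleftrightarrow> no_adjacent_ones w"
  by (induction k) (auto simp: no_adjacent_ones_Cons)

lemma zeck_val_pad [simp]: "zeck_val (replicate k False @ w) = zeck_val w"
  by (induction k) auto

lemma zeck_val_snoc: "zeck_val (w @ [d]) = zeck_val (w @ [False]) + (if d then 1 else 0)"
  by (induction w) auto

lemma zeck_val_append_00: "zeck_val (w @ [False, False]) = zeck_val (w @ [False]) + zeck_val w"
  by (induction w) auto

lemma no_adjacent_ones_snoc:
  "no_adjacent_ones (w @ [d]) \<longleftrightarrow> no_adjacent_ones w \<and> \<not> (d \<and> w \<noteq> [] \<and> last w)"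
proof (induction w)
  case (Cons a w)
  then show ?case by (cases w) (auto simp: no_adjacent_ones_Cons)
qed (simp add: no_adjacent_ones_Cons)

lemma no_adjacent_ones_snoc_False [simp]:
  "no_adjacent_ones (w @ [False]) \<longleftrightarrow> no_adjacent_ones w"
  by (simp add: no_adjacent_ones_snoc)

lemma zeck_val_eqD:
  assumes "no_adjacent_ones u" "no_adjacent_ones w" "zeck_val u = zeck_val w"
  shows "replicate (length w) False @ u = replicate (length u) False @ w"
  using assms by (intro zeck_val_inj) auto

text \<open>Words of equal value agree after padding with leading zeros, so any valid word for a
  number computes its shift.\<close>

lemma zshift_zeck_val:
  assumes "no_adjacent_ones w"
  shows "zshift (zeck_val w) = zeck_val (w @ [False])"
proof -
  have "replicate (length w) False @ zeck (zeck_val w)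
      = replicate (length (zeck (zeck_val w))) False @ w"
    using assms by (intro zeck_val_eqD) auto
  then show ?thesis
    unfolding zshift_def by (metis append_assoc zeck_val_pad)
qed

lemma zshift_0 [simp]: "zshift 0 = 0"
  using zshift_zeck_val[of "[]"] by simp

lemma zshift_zshift: "zshift (zshift n) = zshift n + n"
  using zshift_zeck_val[of "zeck n"] zshift_zeck_val[of "zeck n @ [False]"] zeck_val_append_00[of "zeck n"]
  by simp

text \<open>Valid words of equal length compare lexicographically: where \<open>u\<close> has 0
  against a 1 of \<open>w\<close>, \<open>zeck_val_less\<close> keeps the shifted rest of
  \<open>u\<close> below the shifted weight of that 1.\<close>

lemma zeck_val_snoc_False_mono:
  "\<lbrakk>length u = length w; no_adjacent_ones u; no_adjacent_ones w; zeck_val u < zeck_val w\<rbrakk>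
    \<Longrightarrow> zeck_val (u @ [False]) < zeck_val (w @ [False])"
proof (induction u w rule: list_induct2)
  case (Cons a u b w)
  have v: "no_adjacent_ones u" "no_adjacent_ones w"
    using Cons.prems by (simp_all add: no_adjacent_ones_Cons)
  have "zeck_val w < fib (length w + 2)" "zeck_val (u @ [False]) < fib (length (u @ [False]) + 2)"
    using v by (simp_all only: zeck_val_less no_adjacent_ones_snoc_False)
  with Cons v show ?case
    by (cases a; cases b) auto
qed simp

lemma strict_mono_zshift: "strict_mono zshift"
proof (rule strict_monoI)
  fix m n :: nat
  assume "m < n"
  define u w where "u = replicate (length (zeck n)) False @ zeck m"
    and "w = replicate (length (zeck m)) False @ zeck n"
  have "zeck_val (u @ [False]) < zeck_val (w @ [False])"
    using \<open>m < n\<close> by (intro zeck_val_snoc_False_mono) (auto simp: u_def w_def)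
  then show "zshift m < zshift n"
    by (simp add: u_def w_def zshift_def)
qed

lemmas zshift_less_iff [simp] = strict_mono_less[OF strict_mono_zshift]
  and zshift_le_iff [simp] = strict_mono_less_eq[OF strict_mono_zshift]
  and zshift_eq_iff [simp] = strict_mono_eq[OF strict_mono_zshift]

section \<open>The range of the shift and its gaps\<close>

lemma zeck_val_in_range_zshift:
  assumes "no_adjacent_ones (w @ [d])"
  shows "zeck_val (w @ [d]) \<in> range zshift \<longleftrightarrow> \<not> d"
proof
  assume "zeck_val (w @ [d]) \<in> range zshift"
  then obtain k where "zeck_val (w @ [d]) = zeck_val (zeck k @ [False])"
    by (auto simp: zshift_def)
  from zeck_val_eqD[OF _ _ this] assms show "\<not> d"
    by (metis append_assoc last_snoc no_adjacent_ones_snoc_False no_adjacent_ones_zeck)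
next
  assume "\<not> d"
  then show "zeck_val (w @ [d]) \<in> range zshift"
    using assms zshift_zeck_val[of w] by (metis no_adjacent_ones_snoc rangeI)
qed

text \<open>A final 1 is preceded by 0 or by nothing, so turning it into 0 leaves a twice shifted
  number.\<close>

lemma notin_range_zshift_iff: "m \<notin> range zshift \<longleftrightarrow> (\<exists>k. m = zshift (zshift k) + 1)"
proof
  assume m: "m \<notin> range zshift"
  obtain u d where ud: "zeck m = u @ [d]"
    using m zshift_0 by (metis rangeI rev_exhaust zeck_val_Nil zeck_val_zeck)
  have v: "no_adjacent_ones (u @ [d])" and m_eq: "m = zeck_val (u @ [d])"
    using ud no_adjacent_ones_zeck[of m] zeck_val_zeck[of m] by simp_all
  have d using m v m_eq zeck_val_in_range_zshift by blast
  obtain k where "zeck_val u = zshift k"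
  proof (cases u rule: rev_cases)
    case Nil
    then show ?thesis using that[of 0] by simp
  next
    case (snoc u' e)
    have "no_adjacent_ones u" "\<not> (u \<noteq> [] \<and> last u)"
      using v \<open>d\<close> by (simp_all only: no_adjacent_ones_snoc simp_thms)
    then have "zeck_val u \<in> range zshift"
      using zeck_val_in_range_zshift[of u' e] snoc by simp
    then show ?thesis using that by blast
  qed
  moreover have "m = zshift (zeck_val u) + 1"
    using v \<open>d\<close> m_eq zeck_val_snoc[of u d] zshift_zeck_val[of u] by (simp add: no_adjacent_ones_snoc)
  ultimately show "\<exists>k. m = zshift (zshift k) + 1" by auto
next
  assume "\<exists>k. m = zshift (zshift k) + 1"
  then obtain k where k: "m = zshift (zshift k) + 1" ..
  have v: "no_adjacent_ones ((zeck k @ [False]) @ [True])"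
    by (subst no_adjacent_ones_snoc) simp
  have "zeck_val ((zeck k @ [False]) @ [True]) = zshift (zshift k) + 1"
    using zeck_val_snoc[of "zeck k @ [False]" True] zshift_zeck_val[of "zeck k @ [False]"]
      zshift_zeck_val[of "zeck k"] by simp
  then show "m \<notin> range zshift"
    using zeck_val_in_range_zshift[OF v] k by simp
qed

lemma zshift_Suc_eqI:
  assumes "zshift n < zshift m" "\<And>k. zshift n < k \<Longrightarrow> k < zshift m \<Longrightarrow> k \<notin> range zshift"
  shows "zshift (Suc n) = zshift m"
proof (rule antisym)
  show "zshift (Suc n) \<le> zshift m" using assms(1) by simp
  show "zshift m \<le> zshift (Suc n)" using assms(2)[of "zshift (Suc n)"] by force
qed

text \<open>The range skips \<open>zshift (zshift k) + 1\<close>, and it never skips two consecutive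
  numbers, because the predecessor of a skipped number is a double shift.\<close>

lemma zshift_Suc_zshift: "zshift (Suc (zshift k)) = zshift (zshift k) + 2"
proof -
  have "zshift (zshift k) + 2 \<in> range zshift"
  proof (rule ccontr)
    assume "zshift (zshift k) + 2 \<notin> range zshift"
    then obtain j where "zshift (zshift k) + 2 = zshift (zshift j) + 1"
      using notin_range_zshift_iff by blast
    then have "zshift (zshift k) + 1 \<in> range zshift" by (simp add: rangeI)
    then show False using notin_range_zshift_iff by blast
  qed
  then obtain m where m: "zshift (zshift k) + 2 = zshift m" by auto
  have "zshift (Suc (zshift k)) = zshift m"
  proof (rule zshift_Suc_eqI)
    show "zshift (zshift k) < zshift m" using m by linarith
    fix k' assume "zshift (zshift k) < k'" "k' < zshift m"
    then have "k' = zshift (zshift k) + 1" using m by linarith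
    then show "k' \<notin> range zshift" using notin_range_zshift_iff by blast
  qed
  then show ?thesis using m by simp
qed

lemma zshift_Suc_notin_range:
  assumes "n \<notin> range zshift"
  shows "zshift (Suc n) = zshift n + 1"
proof -
  have "zshift n + 1 \<in> range zshift"
    using assms notin_range_zshift_iff[of "zshift n + 1"] by auto
  then obtain m where m: "zshift n + 1 = zshift m" by auto
  have "zshift (Suc n) = zshift m"
    by (rule zshift_Suc_eqI) (use m in linarith)+
  then show ?thesis using m by simp
qed

lemma zshift_Suc_bounds: "zshift n + 1 \<le> zshift (Suc n)" "zshift (Suc n) \<le> zshift n + 2"
  using zshift_Suc_zshift zshift_Suc_notin_range[of n] by (cases "n \<in> range zshift"; auto)+

lemma zshift_diff_mono: "m \<le> n \<Longrightarrow> zshift m + n \<le> zshift n + m"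
proof (induction n rule: dec_induct)
  case (step n)
  then show ?case using zshift_Suc_bounds(1)[of n] by linarith
qed simp

lemma zshift_ge: "n \<le> zshift n"
  using zshift_diff_mono[of 0 n] by simp

lemma zshift_gt: "0 < n \<Longrightarrow> n < zshift n"
  using zshift_diff_mono[of 1 n] zshift_Suc_zshift[of 0] by simp

text \<open>The difference \<open>zshift n - n\<close> is monotone in \<open>n\<close>, equals
  \<open>j\<close> at \<open>n = zshift j\<close> and \<open>j + 1\<close> at the next number; so it
  counts the \<open>j\<close> with \<open>zshift j < n\<close>.\<close>

lemma zshift_less_iff_diff: "zshift j < n \<longleftrightarrow> j < zshift n - n"
proof
  assume "zshift j < n"
  then have "zshift (Suc (zshift j)) + n \<le> zshift n + Suc (zshift j)"
    by (intro zshift_diff_mono) simp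
  then show "j < zshift n - n"
    by (simp add: zshift_Suc_zshift zshift_zshift)
next
  assume *: "j < zshift n - n"
  show "zshift j < n"
  proof (rule ccontr)
    assume "\<not> zshift j < n"
    then have "zshift n + zshift j \<le> zshift (zshift j) + n"
      by (intro zshift_diff_mono) simp
    then show False using * by (simp add: zshift_zshift)
  qed
qed


subsection \<open>A closed form for the Hurt-Sada array\<close>

text \<open>In the last branch, entries \<open>z > n\<close> satisfy the first equation and entries
  \<open>z \<le> n\<close>, already moved, the second.\<close>

definition hs_rel :: "nat \<Rightarrow> nat \<Rightarrow> nat \<Rightarrow> bool" where
  "hs_rel n k z \<longleftrightarrow>
    (if zshift k \<le> n \<or> zshift n < k then z = k
     else k + n + 1 = zshift z \<or> k + n = zshift (zshift z))"

lemma zshift_neq_Suc_zshift_zshift: "zshift a \<noteq> Suc (zshift (zshift b))"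
  using notin_range_zshift_iff[of "zshift a"] by auto

lemma hs_rel_unique: "hs_rel n k z \<Longrightarrow> hs_rel n k z' \<Longrightarrow> z = z'"
  using zshift_neq_Suc_zshift_zshift[of z z'] zshift_neq_Suc_zshift_zshift[of z' z]
  by (fastforce simp: hs_rel_def split: if_splits)

text \<open>The position solves the first equation for \<open>z = Suc n\<close>. Row 0 is
  exceptional: position 1 still exceeds \<open>zshift 0\<close>, so the fixed branch
  applies.\<close>

lemma hs_rel_pivot: "hs_rel n (zshift (Suc n) - Suc n) (Suc n)"
proof -
  have "\<not> zshift (zshift (Suc n) - Suc n) \<le> n"
    using zshift_less_iff_diff[of "zshift (Suc n) - Suc n" "Suc n"] by simp
  moreover have "Suc n \<le> zshift (Suc n)" by (rule zshift_ge)
  moreover have "zshift (Suc n) - Suc n \<le> zshift n" if "n \<noteq> 0"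
    using zshift_Suc_bounds(2)[of n] that by simp
  moreover have "zshift (Suc 0) = 2" using zshift_Suc_zshift[of 0] by simp
  ultimately show ?thesis
    by (cases "n = 0") (auto simp: hs_rel_def)
qed

text \<open>The position drops by one while the row number grows by one, so both equations persist;
  only passages between branches need work.\<close>

lemma hs_rel_left_shift:
  assumes "hs_rel n (Suc j) z" "zshift (Suc n) - Suc n \<le> j" "j < zshift (Suc n)"
  shows "hs_rel (Suc n) j z"
proof -
  have j: "Suc n \<le> zshift j"
    using assms(2) zshift_less_iff_diff[of j "Suc n"] by linarith
  have *: "\<not> zshift (Suc j) \<le> n"
    using j strict_monoD[OF strict_mono_zshift, of j "Suc j"] by linarith
  show ?thesis
  proof (cases "zshift n < Suc j")
    case False
    then have z: "j + Suc n + 1 = zshift z \<or> j + Suc n = zshift (zshift z)"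
      using assms(1) * by (auto simp: hs_rel_def)
    show ?thesis
    proof (cases "zshift j = Suc n")
      case True
      \<comment> \<open>Position \<open>j\<close> becomes frozen here, so the equations have to
        yield \<open>z = j\<close>.\<close>
      then have "j + Suc n = zshift (zshift j)" using zshift_zshift[of j] by linarith
      then have "z = j" using z zshift_neq_Suc_zshift_zshift[of z j] by auto
      then show ?thesis using True by (simp add: hs_rel_def)
    next
      case False
      then show ?thesis using z j assms(3) by (auto simp: hs_rel_def)
    qed
  next
    case True
    then have z: "z = Suc j" using assms(1) by (simp add: hs_rel_def)
    \<comment> \<open>An entry of the fixed right part starts to move and must meet the first
      equation. By \<open>j < zshift (Suc n) \<le> zshift n + 2\<close>, only
      \<open>zshift n\<close> and \<open>zshift n + 1\<close> are possible for
      \<open>j\<close>.\<close>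
    have S: "zshift (Suc j) = j + Suc n + 1"
    proof (cases "j = zshift n")
      case True
      then show ?thesis using zshift_Suc_zshift[of n] zshift_zshift[of n] by simp
    next
      case False
      with True assms(3) zshift_Suc_bounds(2)[of n] have j_eq: "j = Suc (zshift n)" and "zshift (Suc n) \<noteq> zshift n + 1"
        by linarith+
      then obtain k where "n = zshift k" using zshift_Suc_notin_range[of n] by auto
      then have "j \<notin> range zshift" using j_eq notin_range_zshift_iff by auto
      then show ?thesis
        using zshift_Suc_notin_range j_eq zshift_Suc_zshift[of n] zshift_zshift[of n] by simp
    qed
    have "Suc n < zshift j"
    proof (cases "n = 0")
      case True
      then show ?thesis
        using assms(2,3) zshift_Suc_zshift[of 0] by (simp add: le_Suc_eq less_Suc_eq numeral_eq_Suc)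
    next
      case False
      then have "zshift n + n \<le> zshift j" "n < zshift n"
        using \<open>zshift n < Suc j\<close> zshift_gt[of n] by (simp_all flip: zshift_zshift)
      then show ?thesis using False by linarith
    qed
    then show ?thesis using S z assms(3) by (simp add: hs_rel_def)
  qed
qed

lemma hs_rel_hurt_sada: "hs_rel n k (hurt_sada n k)"
proof (induction n arbitrary: k)
  case 0
  show ?case
    by (cases "k = 0") (auto simp: hs_rel_def)
next
  case (Suc n)
  define i where "i = zshift (Suc n) - Suc n"
  have "hurt_sada n i = Suc n"
    using hs_rel_unique[OF Suc hs_rel_pivot] by (simp add: i_def)
  then have the_i: "(THE j. hurt_sada n j = Suc n) = i"
    using hurt_sada_ex1[of n "Suc n"] by blast
  have i: "i + Suc n = zshift (Suc n)"
    using zshift_ge[of "Suc n"] by (simp add: i_def)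
  consider "k < i" | "i \<le> k" "k < i + Suc n" | "k = i + Suc n" | "i + Suc n < k"
    by linarith
  then show ?case
  proof cases
    case 1
    then have "zshift k \<le> n"
      using zshift_less_iff_diff[of k "Suc n"] by (simp add: i_def)
    moreover have "hurt_sada (Suc n) k = hurt_sada n k"
      using 1 by (simp add: shift_entry_def Let_def the_i)
    ultimately show ?thesis using Suc[of k] by (auto simp: hs_rel_def split: if_splits)
  next
    case 2
    then have "hurt_sada (Suc n) k = hurt_sada n (Suc k)"
      by (simp add: shift_entry_def Let_def the_i)
    then show ?thesis
      using hs_rel_left_shift[OF Suc[of "Suc k"]] 2 i by (simp add: i_def)
  next
    case 3
    then have "hurt_sada (Suc n) k = Suc n"
      by (simp add: shift_entry_def Let_def the_i)
    moreover have "Suc n < zshift (Suc n)" by (rule zshift_gt) simp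
    ultimately show ?thesis
      using 3 i zshift_zshift[of "Suc n"] by (simp add: hs_rel_def)
  next
    case 4
    then have "hurt_sada (Suc n) k = hurt_sada n k"
      by (simp add: shift_entry_def Let_def the_i)
    moreover have "zshift (Suc n) < k" using 4 i by simp
    moreover from this have "zshift n < k" using zshift_Suc_bounds(1)[of n] by linarith
    ultimately show ?thesis using Suc[of k] by (auto simp: hs_rel_def)
  qed
qed

lemma hurt_sada_eq_iff: "hurt_sada n k = z \<longleftrightarrow> hs_rel n k z"
  using hs_rel_hurt_sada hs_rel_unique by blast

subsection \<open>Trackers for the constraints of the closed form\<close>

text \<open>The first difference decides: the left word is smaller iff the right digit is 1.\<close>

fun cmp_step :: "bool option \<Rightarrow> bool \<Rightarrow> bool \<Rightarrow> bool option" where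
  "cmp_step None a b = (if a = b then None else Some b)"
| "cmp_step (Some v) a b = Some v"

text \<open>\<open>None\<close> means that the prefixes read so far agree; the right-hand word runs one letter
  ahead, and \<open>d\<close> is its pending letter.\<close>

fun cmp_less :: "bool option \<Rightarrow> bool \<Rightarrow> bool list \<Rightarrow> bool list \<Rightarrow> bool" where
  "cmp_less None d u w \<longleftrightarrow> zeck_val (u @ [False]) < zeck_val (d # w)"
| "cmp_less (Some v) d u w \<longleftrightarrow> v"

fun cmp_le :: "bool option \<Rightarrow> bool \<Rightarrow> bool list \<Rightarrow> bool list \<Rightarrow> bool" where
  "cmp_le None d u w \<longleftrightarrow> zeck_val (u @ [False]) \<le> zeck_val (d # w)"
| "cmp_le (Some v) d u w \<longleftrightarrow> v"

text \<open>Both remainders stay below \<open>fib (length u + 3)\<close>, the weight of the digits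
  compared, so they cannot reverse a difference.\<close>

lemma cmp_step_correct:
  assumes "length u = length w" "no_adjacent_ones (a # u)" "no_adjacent_ones (b # w)"
  shows "cmp_less (cmp_step c a d) b u w \<longleftrightarrow> cmp_less c d (a # u) (b # w)"
    and "cmp_le (cmp_step c a d) b u w \<longleftrightarrow> cmp_le c d (a # u) (b # w)"
proof -
  have "zeck_val (u @ [False]) < fib (length u + 3)"
    using zeck_val_less[of "u @ [False]"] assms
    by (simp add: no_adjacent_ones_Cons numeral_3_eq_3 del: fib.simps)
  moreover have "zeck_val (b # w) < fib (length u + 3)"
    using zeck_val_less[of "b # w"] assms
    by (simp add: numeral_3_eq_3 del: fib.simps zeck_val_Cons)
  ultimately show "cmp_less (cmp_step c a d) b u w \<longleftrightarrow> cmp_less c d (a # u) (b # w)"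
    and "cmp_le (cmp_step c a d) b u w \<longleftrightarrow> cmp_le c d (a # u) (b # w)"
    using assms(1) by (cases c; cases a; cases d; auto simp: numeral_3_eq_3 simp del: fib.simps)+
qed

type_synonym letter = "bool \<times> bool \<times> bool"

type_synonym tracker = "(int \<times> int) option"

text \<open>The pair \<open>(a, b)\<close> stands for a prefix whose contribution to
  \<open>x + y - zshift (\<dots> (zshift z))\<close> (with \<open>r\<close> shifts) is \<open>a * fib (l + 1) + b * fib l\<close> when \<open>l\<close>
  letters remain. The tracker is dropped once \<open>tracker_dead\<close> holds, since the remaining letters
  can then no longer bring the difference to \<open>-c\<close>.\<close>

definition tracker_sem :: "nat \<Rightarrow> int \<Rightarrow> tracker \<Rightarrow> bool list \<Rightarrow> bool list \<Rightarrow> bool list \<Rightarrow> bool" where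
  "tracker_sem r c e u v w = (case e of None \<Rightarrow> False
    | Some (a, b) \<Rightarrow> a * int (fib (length w + 1)) + b * int (fib (length w))
        + int (zeck_val u) + int (zeck_val v) + c = int (zeck_val (w @ replicate r False)))"

definition tracker_dead :: "int \<Rightarrow> int \<Rightarrow> int \<Rightarrow> int \<Rightarrow> bool" where
  "tracker_dead p q a b \<longleftrightarrow> (a + 2 \<le> 0 \<and> a + b + 4 \<le> 0) \<or> (p \<le> a \<and> p + q \<le> a + b)"

text \<open>With \<open>l\<close> letters left after this one,
  \<open>a * fib (l + 2) + b * fib (l + 1)\<close> is
  \<open>(a + b) * fib (l + 1) + a * fib l\<close>. A digit of \<open>x\<close> or \<open>y\<close>
  weighs \<open>fib (l + 1) + fib l\<close>; one of \<open>z\<close> weighs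
  \<open>p * fib (l + 1) + q * fib l\<close> for \<open>p = fib (r + 2)\<close> and
  \<open>q = fib (r + 1)\<close>.\<close>

fun tracker_step :: "int \<Rightarrow> int \<Rightarrow> tracker \<Rightarrow> letter \<Rightarrow> tracker" where
  "tracker_step p q None l = None"
| "tracker_step p q (Some (a, b)) (x, y, z) =
    (let d = of_bool x + of_bool y; a' = a + b + d - (if z then p else 0);
         b' = a + d - (if z then q else 0)
     in if tracker_dead p q a' b' then None else Some (a', b'))"

lemma fib_combination_nonneg:
  fixes a b :: int
  assumes "0 \<le> a" "0 \<le> a + b"
  shows "0 \<le> a * int (fib (Suc n)) + b * int (fib n)"
proof -
  have "fib n \<le> fib (Suc n)" by (rule fib_mono) simp
  then have "0 \<le> a * (int (fib (Suc n)) - int (fib n))"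
    using assms(1) by simp
  moreover have "0 \<le> (a + b) * int (fib n)"
    using assms(2) by simp
  ultimately show ?thesis by (simp add: algebra_simps)
qed

lemma no_adjacent_ones_append_zeros:
  "no_adjacent_ones w \<Longrightarrow> no_adjacent_ones (w @ replicate r False)"
  by (induction r) (simp_all flip: replicate_append_same append_assoc)

lemma fib_add_int: "int (fib (n + Suc k)) = int (fib (Suc k)) * int (fib (Suc n)) + int (fib k) * int (fib n)"
  using fib_add[of n k] by (simp add: mult.commute)

text \<open>The rests of \<open>u\<close> and \<open>v\<close> together stay below
  \<open>2 * fib (l + 2)\<close>, too little to lift the left side to 0 in the first case; the rest
  of \<open>w\<close> stays below \<open>fib (l + r + 2)\<close>, too little to catch up in the
  second.\<close>

lemma tracker_dead_sem:
  assumes "tracker_dead (int (fib (r + 2))) (int (fib (r + 1))) a b"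
    and c: "0 \<le> c" "c \<le> 1"
    and len: "length u = length w" "length v = length w"
    and v: "no_adjacent_ones u" "no_adjacent_ones v" "no_adjacent_ones w"
  shows "\<not> tracker_sem r c (Some (a, b)) u v w"
proof
  let ?l = "length w"
  let ?W = "zeck_val (w @ replicate r False)"
  assume "tracker_sem r c (Some (a, b)) u v w"
  then have eq: "a * int (fib (Suc ?l)) + b * int (fib ?l)
      + int (zeck_val u) + int (zeck_val v) + c = int ?W"
    by (simp add: tracker_sem_def)
  have "zeck_val u < fib (?l + 2)" "zeck_val v < fib (?l + 2)"
    using zeck_val_less[OF v(1)] zeck_val_less[OF v(2)] len by simp_all
  then have uv: "zeck_val u + 1 \<le> fib (Suc ?l) + fib ?l" "zeck_val v + 1 \<le> fib (Suc ?l) + fib ?l"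
    by simp_all
  have "?W < fib (?l + Suc (r + 1))"
    using zeck_val_less[OF no_adjacent_ones_append_zeros[OF v(3), of r]] by (simp add: add.commute)
  then have W: "int ?W < int (fib (r + 2)) * int (fib (Suc ?l)) + int (fib (r + 1)) * int (fib ?l)"
    using fib_add_int[of ?l "r + 1"] by simp
  show False
  proof (cases "a + 2 \<le> 0 \<and> a + b + 4 \<le> 0")
    case True
    then have "0 \<le> (- a - 2) * int (fib (Suc ?l)) + (- b - 2) * int (fib ?l)"
      by (intro fib_combination_nonneg) auto
    then show False using eq uv c by (simp add: algebra_simps)
  next
    case False
    then have "0 \<le> (a - int (fib (r + 2))) * int (fib (Suc ?l)) + (b - int (fib (r + 1))) * int (fib ?l)"
      using assms(1) by (intro fib_combination_nonneg) (auto simp: tracker_dead_def)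
    then show False using eq W c by (simp add: algebra_simps)
  qed
qed

lemma tracker_step_correct:
  assumes c: "0 \<le> c" "c \<le> 1"
    and len: "length u = length w" "length v = length w"
    and v: "no_adjacent_ones u" "no_adjacent_ones v" "no_adjacent_ones w"
    and pq: "p = int (fib (r + 2))" "q = int (fib (r + 1))"
  shows "tracker_sem r c (tracker_step p q e (x, y, z)) u v w
    \<longleftrightarrow> tracker_sem r c e (x # u) (y # v) (z # w)"
proof (cases e)
  case None
  then show ?thesis by (simp add: tracker_sem_def)
next
  case (Some ab)
  obtain a b where ab: "ab = (a, b)" by fastforce
  define a' b' where "a' = a + b + (of_bool x + of_bool y) - (if z then p else 0)"
    and "b' = a + (of_bool x + of_bool y) - (if z then q else 0)"
  have step: "tracker_step p q e (x, y, z) = (if tracker_dead p q a' b' then None else Some (a', b'))"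
    by (simp add: Some ab a'_def b'_def Let_def)
  have "fib (length w + r + 2) = fib (length w + Suc (r + 1))" by simp
  then have f: "int (fib (length w + r + 2)) = p * int (fib (Suc (length w))) + q * int (fib (length w))"
    using fib_add_int[of "length w" "r + 1"] pq by simp
  have "tracker_sem r c (Some (a', b')) u v w \<longleftrightarrow> tracker_sem r c e (x # u) (y # v) (z # w)"
    using f len by (auto simp: Some ab tracker_sem_def a'_def b'_def algebra_simps of_bool_def)
  moreover have "\<not> tracker_sem r c (Some (a', b')) u v w" if "tracker_dead p q a' b'"
    using tracker_dead_sem that assms by blast
  ultimately show ?thesis
    using step by (auto simp: tracker_sem_def)
qed


subsection \<open>The product of the trackers\<close>

text \<open>The components track \<open>zshift y \<le> x\<close>, \<open>zshift x < y\<close>,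
  \<open>y = z\<close>, \<open>x + y + 1 = zshift z\<close>,
  \<open>x + y = zshift (zshift z)\<close> and the last letter, which holds the pending
  digits.\<close>

type_synonym prod_state = "bool option \<times> bool option \<times> bool \<times> tracker \<times> tracker \<times> letter"

text \<open>Only reduces the number of reachable states.\<close>

fun prune :: "prod_state \<Rightarrow> prod_state" where
  "prune (c1, c2, e0, e1, e2, l) =
    (if c1 = Some True \<or> c2 = Some True \<or> \<not> e0 \<and> e1 = None \<and> e2 = None
     then (Some True, Some True, e0, None, None, l)
     else (c1, c2, e0 \<and> \<not> (c1 = Some False \<and> c2 = Some False), e1, e2, l))"

fun prod_step :: "letter \<Rightarrow> prod_state \<Rightarrow> prod_state" where
  "prod_step (x, y, z) (c1, c2, e0, e1, e2, (x', y', z')) =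
    prune (cmp_step c1 y x', cmp_step c2 x y', e0 \<and> y = z,
      tracker_step 2 1 e1 (x, y, z), tracker_step 3 2 e2 (x, y, z), (x, y, z))"

definition prod_init :: prod_state where
  "prod_init = (None, None, True, Some (0, 0), Some (0, 0), (False, False, False))"

fun tracker_final :: "int \<Rightarrow> tracker \<Rightarrow> bool" where
  "tracker_final c None \<longleftrightarrow> False"
| "tracker_final c (Some (a, b)) \<longleftrightarrow> a + c = 0"

text \<open>An undecided comparison ends with the appended 0 against the pending digit:
  \<open>\<le>\<close> always holds, \<open><\<close> iff that digit is 1.\<close>

fun prod_accept :: "prod_state \<Rightarrow> bool" where
  "prod_accept (c1, c2, e0, e1, e2, (x', y', z')) \<longleftrightarrow>
    (if c1 \<noteq> Some False \<or> c2 = Some True \<or> c2 = None \<and> y' then e0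
     else tracker_final 1 e1 \<or> tracker_final 0 e2)"

fun prod_sem :: "prod_state \<Rightarrow> bool list \<Rightarrow> bool list \<Rightarrow> bool list \<Rightarrow> bool" where
  "prod_sem (c1, c2, e0, e1, e2, (x', y', z')) u v w \<longleftrightarrow>
    (if cmp_le c1 x' v u \<or> cmp_less c2 y' u v then e0 \<and> zeck_val v = zeck_val w
     else tracker_sem 1 1 e1 u v w \<or> tracker_sem 2 0 e2 u v w)"

fun can_follow :: "letter \<Rightarrow> letter \<Rightarrow> bool" where
  "can_follow (x, y, z) (x', y', z') \<longleftrightarrow> \<not> (x \<and> x') \<and> \<not> (y \<and> y') \<and> \<not> (z \<and> z')"

fun last_letter :: "prod_state \<Rightarrow> letter" where
  "last_letter (c1, c2, e0, e1, e2, l) = l"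

fun valid_from :: "letter \<Rightarrow> letter list \<Rightarrow> bool" where
  "valid_from l [] \<longleftrightarrow> True"
| "valid_from l (m # ws) \<longleftrightarrow> can_follow l m \<and> valid_from m ws"

lemma valid_from_iff:
  "valid_from (x, y, z) ws \<longleftrightarrow> no_adjacent_ones (x # map fst ws)
    \<and> no_adjacent_ones (y # map (fst \<circ> snd) ws) \<and> no_adjacent_ones (z # map (snd \<circ> snd) ws)"
proof (induction ws arbitrary: x y z)
  case (Cons l ws)
  then show ?case by (cases l) (auto simp: no_adjacent_ones_Cons[of _ "_ # _"])
qed (simp add: no_adjacent_ones_Cons)

text \<open>A positive comparison makes both equations irrelevant, two negative ones make
  \<open>e0\<close> irrelevant, and with all three conditions lost the state rejects.\<close>

lemma prod_sem_prune: "prod_sem (prune s) u v w \<longleftrightarrow> prod_sem s u v w"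
  by (cases s rule: prune.cases) (auto simp: tracker_sem_def split: if_splits)

lemma last_letter_prod_step: "last_letter (prod_step l s) = l"
  by (cases "(l, s)" rule: prod_step.cases) auto

lemma prod_step_sem:
  assumes len: "length u = length w" "length v = length w"
    and v: "no_adjacent_ones (x # u)" "no_adjacent_ones (y # v)" "no_adjacent_ones (z # w)"
  shows "prod_sem (prod_step (x, y, z) s) u v w \<longleftrightarrow> prod_sem s (x # u) (y # v) (z # w)"
proof -
  obtain c1 c2 e0 e1 e2 x' y' z' where s: "s = (c1, c2, e0, e1, e2, (x', y', z'))"
    by (metis prod.exhaust)
  have v': "no_adjacent_ones u" "no_adjacent_ones v" "no_adjacent_ones w"
    using v by (simp_all add: no_adjacent_ones_Cons)
  have "zeck_val (y # v) = zeck_val (z # w) \<longleftrightarrow> y = z \<and> zeck_val v = zeck_val w"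
    using zeck_val_inj[of "y # v" "z # w"] len v by auto
  moreover have "cmp_le (cmp_step c1 y x') x v u \<longleftrightarrow> cmp_le c1 x' (y # v) (x # u)"
    using cmp_step_correct(2) len v by auto
  moreover have "cmp_less (cmp_step c2 x y') y u v \<longleftrightarrow> cmp_less c2 y' (x # u) (y # v)"
    using cmp_step_correct(1) len v by auto
  moreover have "tracker_sem 1 1 (tracker_step 2 1 e1 (x, y, z)) u v w
      \<longleftrightarrow> tracker_sem 1 1 e1 (x # u) (y # v) (z # w)"
    using len v' by (intro tracker_step_correct) (auto simp: numeral_eq_Suc)
  moreover have "tracker_sem 2 0 (tracker_step 3 2 e2 (x, y, z)) u v w
      \<longleftrightarrow> tracker_sem 2 0 e2 (x # u) (y # v) (z # w)"
    using len v' by (intro tracker_step_correct) (auto simp: numeral_eq_Suc)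
  ultimately show ?thesis
    unfolding s prod_step.simps prod_sem_prune prod_sem.simps by (simp only: conj_assoc)
qed

lemma prod_accept_sem: "prod_accept s \<longleftrightarrow> prod_sem s [] [] []"
proof -
  obtain c1 c2 e0 e1 e2 x' y' z' where s: "s = (c1, c2, e0, e1, e2, (x', y', z'))"
    by (metis prod.exhaust)
  have "tracker_final c e \<longleftrightarrow> tracker_sem r c e [] [] []" for c r e
    using zeck_val_pad[of r "[]"] by (cases e) (auto simp: tracker_sem_def)
  then show ?thesis
    unfolding s by (cases c1; cases c2) auto
qed

lemma fold_prod_step_accept:
  "valid_from (last_letter s) ws \<Longrightarrow> prod_accept (fold prod_step ws s)
    \<longleftrightarrow> prod_sem s (map fst ws) (map (fst \<circ> snd) ws) (map (snd \<circ> snd) ws)"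
proof (induction ws arbitrary: s)
  case Nil
  then show ?case by (simp add: prod_accept_sem)
next
  case (Cons l ws)
  obtain x y z where l: "l = (x, y, z)" by (metis prod.exhaust)
  show ?case
    using Cons last_letter_prod_step[of l s] valid_from_iff[of x y z ws]
      prod_step_sem[of "map fst ws" "map (snd \<circ> snd) ws" "map (fst \<circ> snd) ws" x y z s]
    by (simp add: l comp_def)
qed

lemma prod_sem_init:
  assumes "length u = length w" "length v = length w"
    and "no_adjacent_ones u" "no_adjacent_ones v" "no_adjacent_ones w"
  shows "prod_sem prod_init u v w \<longleftrightarrow> hs_rel (zeck_val u) (zeck_val v) (zeck_val w)"
proof -
  have "zeck_val (w @ [False, False]) = zshift (zshift (zeck_val w))"
    using zshift_zeck_val[of w] zshift_zeck_val[of "w @ [False]"] assms by simp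
  moreover have "int a + int b = int c \<longleftrightarrow> b + a = c" "int a + int b + 1 = int c \<longleftrightarrow> b + a + 1 = c"
    for a b c :: nat by linarith+
  ultimately show ?thesis
    using assms
    by (auto simp: prod_init_def hs_rel_def tracker_sem_def zshift_zeck_val numeral_2_eq_2)
qed


subsection \<open>The automaton\<close>

text \<open>Row \<open>q\<close> lists the successors of state \<open>q\<close> under the letters \<open>000, 001, \<dots>, 111\<close>; the number
  52 marks a missing transition.\<close>

definition hs_table :: "nat list list" where
  "hs_table =
  [[0,1,2,3,4,5,6,7], [52,52,52,52,52,52,8,52],
   [52,52,52,52,52,9,52,52], [10,52,52,52,11,52,52,52],
   [10,52,52,12,52,52,52,52], [52,52,13,52,52,52,52,52],
   [52,14,52,52,52,52,52,52], [15,52,52,52,52,52,52,52],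
   [16,52,52,52,52,52,52,52], [17,52,2,52,52,52,52,52],
   [10,52,52,18,19,52,52,20], [21,1,52,3,52,52,52,52],
   [22,52,52,52,4,52,52,52], [23,1,52,52,52,5,52,52],
   [24,52,6,52,6,52,52,52], [25,26,27,28,29,28,30,52],
   [1,52,31,52,32,52,33,52], [17,52,2,52,34,52,6,35],
   [10,52,52,52,19,52,52,52], [10,52,52,18,52,52,52,52],
   [10,52,52,52,52,52,52,52], [21,1,52,3,36,32,52,28],
   [22,52,37,52,4,52,6,35], [23,1,36,31,52,5,52,28],
   [38,39,52,40,52,41,52,42], [52,43,52,52,52,52,35,52],
   [16,52,44,52,45,52,36,52], [39,52,52,52,41,52,52,52],
   [46,52,52,52,52,52,52,52], [39,52,40,52,52,52,52,52],
   [47,52,52,52,52,52,52,52], [16,52,52,52,45,52,52,52],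
   [16,52,44,52,52,52,52,52], [46,16,52,52,52,52,52,52],
   [38,39,52,40,52,52,52,52], [39,52,52,52,52,52,52,52],
   [52,43,52,52,52,52,52,52], [38,39,52,52,52,41,52,52],
   [52,48,52,42,52,42,52,52], [49,52,27,52,29,52,30,52],
   [50,52,52,52,34,52,52,52], [50,52,37,52,52,52,52,52],
   [38,52,52,52,52,52,52,52], [51,52,36,52,36,52,52,52],
   [51,1,52,52,36,32,52,52], [51,1,36,31,52,52,52,52],
   [36,26,52,28,52,28,52,52], [24,49,6,27,6,29,52,30],
   [50,52,37,52,34,52,6,52], [52,52,52,52,52,52,35,52],
   [50,52,37,52,34,52,6,35], [51,1,36,31,36,32,52,28]]"

definition hs_accepting :: "nat list" where
  "hs_accepting = [0, 3, 4, 8, 9, 10, 12, 16, 17, 18, 19, 20, 22, 26, 30, 31, 32, 40, 41, 48, 50]"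

text \<open>The absorbing value 52 makes the step total, so a run is a plain
  \<open>fold\<close>.\<close>

fun hs_next :: "letter \<Rightarrow> nat \<Rightarrow> nat" where
  "hs_next (x, y, z) q = (if q < 52
     then hs_table ! q ! ((if x then 4 else 0) + (if y then 2 else 0) + (if z then 1 else 0))
     else 52)"

definition hs_automaton :: "(nat, letter) automaton" where
  "hs_automaton = \<lparr>states = {0..<52}, init = 0,
     delta = (\<lambda>q l. let q' = hs_next l q in if q' < 52 then Some q' else None),
     accepting = set hs_accepting\<rparr>"

section \<open>Comparing the table with the product\<close>

definition letters :: "letter list" where
  "letters = List.product [False, True] (List.product [False, True] [False, True])"

text \<open>The product is only meaningful on words without adjacent ones, so only such
  continuations are followed.\<close>

definition succs :: "nat \<times> prod_state \<Rightarrow> (nat \<times> prod_state) list" where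
  "succs = (\<lambda>(q, s). map (\<lambda>l. (hs_next l q, prod_step l s)) (filter (can_follow (last_letter s)) letters))"

definition agree :: "nat \<times> prod_state \<Rightarrow> bool" where
  "agree = (\<lambda>(q, s). List.member hs_accepting q = prod_accept s)"

fun explore :: "nat \<Rightarrow> (nat \<times> prod_state) list \<Rightarrow> (nat \<times> prod_state) list \<Rightarrow> bool" where
  "explore n [] seen = True"
| "explore 0 (p # todo) seen = False"
| "explore (Suc n) (p # todo) seen =
    (if List.member seen p then explore n todo seen
     else agree p \<and> explore n (succs p @ todo) (p # seen))"

text \<open>Every seen pair agrees and has its successors seen or still to do; once nothing is left
  to do, the seen pairs form a closed set.\<close>

lemma explore_sound:
  assumes "explore n todo seen"
    and "\<forall>p \<in> set seen. agree p \<and> set (succs p) \<subseteq> set seen \<union> set todo"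
  shows "\<exists>R. set seen \<union> set todo \<subseteq> R \<and> (\<forall>p \<in> R. agree p \<and> set (succs p) \<subseteq> R)"
  using assms
proof (induction n todo seen rule: explore.induct)
  case (1 n seen)
  then show ?case by (intro exI[of _ "set seen"]) auto
next
  case (3 n p todo seen)
  show ?case
  proof (cases "p \<in> set seen")
    case True
    have "set seen \<union> set (p # todo) = set seen \<union> set todo" using True by auto
    then show ?thesis using 3 True by simp
  next
    case False
    then have "\<exists>R. set (p # seen) \<union> set (succs p @ todo) \<subseteq> R \<and> (\<forall>p \<in> R. agree p \<and> set (succs p) \<subseteq> R)"
      using 3 by (intro "3.IH"(2)) auto
    then show ?thesis by auto
  qed
qed simp

text \<open>By evaluation; 1000 bounds the number of pairs taken from the worklist, repetitions
  included.\<close>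

lemma explore_hs_table: "explore 1000 [(0, prod_init)] []"
  by code_simp

lemma fold_hs_next_agree:
  assumes "\<forall>p \<in> R. agree p \<and> set (succs p) \<subseteq> R"
  shows "\<lbrakk>(q, s) \<in> R; valid_from (last_letter s) ws\<rbrakk>
    \<Longrightarrow> agree (fold hs_next ws q, fold prod_step ws s)"
proof (induction ws arbitrary: q s)
  case Nil
  then show ?case using assms by auto
next
  case (Cons l ws)
  have "l \<in> set letters" by (cases l) (auto simp: letters_def)
  then have "(hs_next l q, prod_step l s) \<in> set (succs (q, s))"
    using Cons.prems(2) by (auto simp: succs_def)
  then have "(hs_next l q, prod_step l s) \<in> R" using assms Cons.prems(1) by blast
  then show ?case using Cons by (simp add: last_letter_prod_step)
qed

lemma fold_hs_next_52 [simp]: "52 \<le> q \<Longrightarrow> 52 \<le> fold hs_next ws q"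
proof (induction ws arbitrary: q)
  case (Cons l ws)
  then show ?case by (cases l) simp
qed simp

lemma run_from_hs_automaton:
  "q < 52 \<Longrightarrow> run_from hs_automaton q ws
    = (let q' = fold hs_next ws q in if q' < 52 then Some q' else None)"
proof (induction ws arbitrary: q)
  case (Cons l ws)
  have d: "delta hs_automaton q l = (if hs_next l q < 52 then Some (hs_next l q) else None)"
    by (simp add: hs_automaton_def Let_def)
  show ?case
    using Cons fold_hs_next_52[of "hs_next l q" ws]
    by (cases "hs_next l q < 52") (simp_all add: d Let_def del: fold_hs_next_52)
qed simp

lemma finite_automaton_hs: "finite_automaton hs_automaton"
  by (auto simp: finite_automaton_def hs_automaton_def hs_accepting_def Let_def split: if_splits)

lemma accepts_hs_automaton:
  "accepts hs_automaton ws \<longleftrightarrow> fold hs_next ws 0 \<in> set hs_accepting"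
proof -
  have "\<forall>q \<in> set hs_accepting. q < 52" by (simp add: hs_accepting_def)
  then show ?thesis
    using run_from_hs_automaton[of 0 ws]
    by (auto simp: accepts_def hs_automaton_def Let_def split: if_splits)
qed

lemma length_pad_front: "length w \<le> l \<Longrightarrow> length (pad_front l w) = l"
  by (simp add: pad_front_def)

lemma map_zip3:
  assumes "length u = length v" "length v = length w"
  shows "map fst (zip u (zip v w)) = u" "map (fst \<circ> snd) (zip u (zip v w)) = v"
    "map (snd \<circ> snd) (zip u (zip v w)) = w"
  using assms by (simp_all flip: map_map)

theorem theorem1:
  shows "\<exists>M :: (nat, bool \<times> bool \<times> bool) automaton.
    finite_automaton M \<and> card (states M) = 52 \<and>
    (\<forall>x y z. accepts M (zeck_triple x y z) \<longleftrightarrow> hurt_sada x y = z)"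
proof (intro exI[of _ hs_automaton] conjI allI)
  show "finite_automaton hs_automaton" by (rule finite_automaton_hs)
  show "card (states hs_automaton) = 52" by (simp add: hs_automaton_def)
next
  fix x y z
  define l where "l = max (length (zeck x)) (max (length (zeck y)) (length (zeck z)))"
  define u v w where "u = pad_front l (zeck x)" and "v = pad_front l (zeck y)"
    and "w = pad_front l (zeck z)"
  have len: "length u = l" "length v = l" "length w = l"
    by (simp_all add: u_def v_def w_def l_def length_pad_front)
  have na: "no_adjacent_ones u" "no_adjacent_ones v" "no_adjacent_ones w"
    and val: "zeck_val u = x" "zeck_val v = y" "zeck_val w = z"
    by (simp_all add: u_def v_def w_def pad_front_def)
  have triple: "zeck_triple x y z = zip u (zip v w)"
    by (simp add: zeck_triple_def Let_def u_def v_def w_def l_def)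
  \<comment> \<open>The initial last letter is all zeros, so it constrains no first letter.\<close>
  have valid: "valid_from (last_letter prod_init) (zip u (zip v w))"
    using na len by (simp add: prod_init_def valid_from_iff map_zip3 no_adjacent_ones_Cons)
  obtain R where "(0, prod_init) \<in> R" "\<forall>p \<in> R. agree p \<and> set (succs p) \<subseteq> R"
    using explore_sound[OF explore_hs_table] by auto
  then have "agree (fold hs_next (zip u (zip v w)) 0, fold prod_step (zip u (zip v w)) prod_init)"
    using fold_hs_next_agree valid by blast
  then have "accepts hs_automaton (zeck_triple x y z)
      \<longleftrightarrow> prod_accept (fold prod_step (zip u (zip v w)) prod_init)"
    by (simp add: accepts_hs_automaton triple agree_def)
  also have "\<dots> \<longleftrightarrow> hs_rel x y z"
    using fold_prod_step_accept[OF valid] prod_sem_init[of u w v] len na val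
    by (simp add: map_zip3)
  finally show "accepts hs_automaton (zeck_triple x y z) \<longleftrightarrow> hurt_sada x y = z"
    by (simp add: hurt_sada_eq_iff)
qed

end
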